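(* Fix $0<t_0<T$, $C\in[C_-,C_+]$, and a finite compatible spatial discretization. For arbitrary initial data $U_0$ bounded independently of $\delta$, $$\sup_{0<\delta\le\delta_0}\ \max_{t_0\le n\Delta t\le T}\|R(\Delta tA_{h,\delta})^nU_0-e^{t_nA_{h,\delta}}U_0\|\le K_{h,t_0,T}\,\Delta t^4\,\|U_0\|,\qquad t_n=n\Delta t,$$ with $K_{h,t_0,T}$ independent of $\delta$ and $\Delta t$.
   Context: A finite compatible spatial discretization consists of finite-dimensional Hilbert spaces $X_h,Q_h$, a constant $a>0$, and linear maps $G_h:X_h\to Q_h$, $D_h:Q_h\to X_h$ with $D_h=-G_h^*$. On $X_h\times Q_h$ put $$A_{h,\delta}=\begin{bmatrix}0&-D_h\\-(a/\delta)G_h&-(1/\delta)I\end{bmatrix}.$$ The number $\delta_0>0$ is fixed with $4a\delta_0\sigma_{\max}^2<1$, where $\sigma_{\max}$ is the largest nonzero singular value of $G_h$. Set $C_\pm=\frac{25\pm\sqrt{105}}{780}$, $a_0=\frac16+\frac72C$, $a_1=\frac23-10C$, $a_2=\frac16+\frac{13}2C$, $H(z)=\frac{1+z/4+z^2/48}{1-z/4+z^2/48}$ and $R(z)=\frac{1+a_0z+Cz^2+(a_1z-Cz^2)H(z)}{1-a_2z+\frac32Cz^2}$; $R(M)$ is the rational function of the operator $M$. *)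

theory Defs
  imports "HOL-Analysis.Analysis" "HOL-Computational_Algebra.Polynomial"
begin

text \<open>The Hilbert spaces \<open>X\<close> and \<open>Q\<close> are arbitrary types of class \<open>euclidean_space\<close>, and
  \<open>X \<times> Q\<close> is the library's product, with inner product
  \<open>(x, q) \<bullet> (x', q') = x \<bullet> x' + q \<bullet> q'\<close>.\<close>

definition compatible_discretization ::
  "real \<Rightarrow> ('x::euclidean_space \<Rightarrow> 'q::euclidean_space) \<Rightarrow> ('q \<Rightarrow> 'x) \<Rightarrow> bool" where
  "compatible_discretization a G D \<longleftrightarrow>
     a > 0 \<and> linear G \<and> linear D \<and> D = (\<lambda>q. - adjoint G q)"

definition block_op ::
  "real \<Rightarrow> ('x::euclidean_space \<Rightarrow> 'q::euclidean_space) \<Rightarrow> ('q \<Rightarrow> 'x) \<Rightarrow> real \<Rightarrow> 'x \<times> 'q \<Rightarrow> 'x \<times> 'q"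
  where
  "block_op a G D \<delta> = (\<lambda>(x, q). (- D q, - (a / \<delta>) *\<^sub>R G x - (1 / \<delta>) *\<^sub>R q))"

definition singular_value :: "('x::euclidean_space \<Rightarrow> 'q::euclidean_space) \<Rightarrow> real \<Rightarrow> bool" where
  "singular_value G s \<longleftrightarrow> s \<ge> 0 \<and> (\<exists>x. x \<noteq> 0 \<and> adjoint G (G x) = s\<^sup>2 *\<^sub>R x)"

text \<open>The inserted \<open>0\<close> only matters for \<open>G = 0\<close>, which has no nonzero singular value;
  there the maximum is \<open>0\<close> by convention.\<close>

definition sigma_max :: "('x::euclidean_space \<Rightarrow> 'q::euclidean_space) \<Rightarrow> real" where
  "sigma_max G = Max (insert 0 {s. singular_value G s \<and> s \<noteq> 0})"

definition op_exp :: "('v::real_normed_vector \<Rightarrow> 'v) \<Rightarrow> 'v \<Rightarrow> 'v" where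
  "op_exp M u = (\<Sum>k. (1 / fact k) *\<^sub>R (M ^^ k) u)"

definition poly_op :: "real poly \<Rightarrow> ('v::real_vector \<Rightarrow> 'v) \<Rightarrow> 'v \<Rightarrow> 'v" where
  "poly_op p M u = (\<Sum>i\<le>degree p. coeff p i *\<^sub>R (M ^^ i) u)"

definition C_minus :: real where "C_minus = (25 - sqrt 105) / 780"
definition C_plus :: real where "C_plus = (25 + sqrt 105) / 780"

definition coeff_a0 :: "real \<Rightarrow> real" where "coeff_a0 C = 1/6 + 7/2 * C"
definition coeff_a1 :: "real \<Rightarrow> real" where "coeff_a1 C = 2/3 - 10 * C"
definition coeff_a2 :: "real \<Rightarrow> real" where "coeff_a2 C = 1/6 + 13/2 * C"

text \<open>The rational functions
  \<open>H(z) = (1 + z/4 + z^2/48) / (1 - z/4 + z^2/48)\<close> and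
  \<open>R(z) = (1 + a\<^sub>0 z + C z^2 + (a\<^sub>1 z - C z^2) H(z)) / (1 - a\<^sub>2 z + 3/2 C z^2)\<close>
  evaluated at an operator, where \<open>1/p(z)\<close> becomes the inverse map of \<open>p(M)\<close>. For the operators
  of interest both denominators are bijective, see \<open>denominators_bij\<close> below.\<close>

definition H_op :: "('v::real_vector \<Rightarrow> 'v) \<Rightarrow> 'v \<Rightarrow> 'v" where
  "H_op M u = inv (poly_op [:1, -1/4, 1/48:] M) (poly_op [:1, 1/4, 1/48:] M u)"

definition R_op :: "real \<Rightarrow> ('v::real_vector \<Rightarrow> 'v) \<Rightarrow> 'v \<Rightarrow> 'v" where
  "R_op C M u =
     inv (poly_op [:1, - coeff_a2 C, 3/2 * C:] M)
       (poly_op [:1, coeff_a0 C, C:] M u + poly_op [:0, coeff_a1 C, - C:] M (H_op M u))"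

lemma poly_op_quadratic:
  "poly_op [:1, b, c:] M u = u + b *\<^sub>R M u + c *\<^sub>R M (M u)"
  by (auto simp: poly_op_def numeral_2_eq_2)

lemma C_minus_pos: "C_minus > 0"
proof -
  have "sqrt 105 < 25" by (rule real_less_lsqrt) auto
  then show ?thesis by (simp add: C_minus_def)
qed

lemma poly_op_block_op_bij:
  fixes G :: "'x::euclidean_space \<Rightarrow> 'q::euclidean_space"
  assumes disc: "compatible_discretization a G D" and \<delta>: "\<delta> > 0" and \<tau>: "\<tau> > 0"
    and b: "b > 0" and c: "c > 0"
  shows "bij (poly_op [:1, - b, c:] (\<lambda>u. \<tau> *\<^sub>R block_op a G D \<delta> u))"
proof -
  define M where "M = (\<lambda>u. \<tau> *\<^sub>R block_op a G D \<delta> u)"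
  define w where "w = (\<lambda>(u :: 'x \<times> 'q) v. a * (fst u \<bullet> fst v) + \<delta> * (snd u \<bullet> snd v))"
  have a: "a > 0" and G: "linear G" and D: "linear D" and DG: "D = (\<lambda>q. - adjoint G q)"
    using disc by (auto simp: compatible_discretization_def)
  have linM: "linear M"
    unfolding M_def block_op_def
    by (rule linearI)
      (auto simp: linear_add[OF G] linear_add[OF D] linear_cmul[OF G] linear_cmul[OF D]
        split_beta algebra_simps)
  have diss: "w u (M u) \<le> 0" for u
  proof -
    have "w u (M u) = - \<tau> * (snd u \<bullet> snd u)"
      using \<delta> adjoint_works[OF G, of "fst u" "snd u"]
      by (simp add: w_def M_def block_op_def DG split_beta field_simps inner_diff_right inner_commute)
    then show ?thesis using \<tau> by simp
  qed
  have linP: "linear (poly_op [:1, - b, c:] M)"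
    unfolding poly_op_quadratic
    by (rule linearI) (auto simp: linear_add[OF linM] linear_cmul[OF linM] algebra_simps)
  moreover have "inj (poly_op [:1, - b, c:] M)"
  proof (rule linear_injective_0[OF linP, THEN iffD2], intro allI impI)
    fix u assume "poly_op [:1, - b, c:] M u = 0"
    then have u: "u = b *\<^sub>R M u - c *\<^sub>R M (M u)"
      by (simp add: poly_op_quadratic algebra_simps)
    have "w u (M u) = b * w (M u) (M u) - c * w (M u) (M (M u))"
      by (subst (1) u) (simp add: w_def inner_diff_left inner_commute algebra_simps)
    moreover have "c * w (M u) (M (M u)) \<le> 0"
      using c diss by (simp add: mult_nonneg_nonpos)
    ultimately have "b * w (M u) (M u) \<le> 0" using diss[of u] by linarith
    then have "w (M u) (M u) \<le> 0" using b by (simp add: mult_le_0_iff)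
    moreover have "a * (fst (M u) \<bullet> fst (M u)) \<ge> 0" "\<delta> * (snd (M u) \<bullet> snd (M u)) \<ge> 0"
      using a \<delta> by auto
    ultimately have "a * (fst (M u) \<bullet> fst (M u)) = 0" "\<delta> * (snd (M u) \<bullet> snd (M u)) = 0"
      unfolding w_def by linarith+
    then have "M u = 0" using a \<delta> by (simp add: prod_eq_iff)
    then show "u = 0" using u linear_0[OF linM] by simp
  qed
  ultimately show ?thesis
    unfolding M_def[symmetric] bij_def using linear_injective_imp_surjective by blast
qed

lemma denominators_bij:
  fixes G :: "'x::euclidean_space \<Rightarrow> 'q::euclidean_space"
  assumes "compatible_discretization a G D" and "\<delta> > 0" and "\<tau> > 0" and "C \<in> {C_minus..C_plus}"
  shows "bij (poly_op [:1, -1/4, 1/48:] (\<lambda>u. \<tau> *\<^sub>R block_op a G D \<delta> u))"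
    and "bij (poly_op [:1, - coeff_a2 C, 3/2 * C:] (\<lambda>u. \<tau> *\<^sub>R block_op a G D \<delta> u))"
proof -
  have "C > 0" using assms(4) C_minus_pos by auto
  then show "bij (poly_op [:1, - coeff_a2 C, 3/2 * C:] (\<lambda>u. \<tau> *\<^sub>R block_op a G D \<delta> u))"
    by (intro poly_op_block_op_bij[OF assms(1-3)]) (auto simp: coeff_a2_def)
  show "bij (poly_op [:1, -1/4, 1/48:] (\<lambda>u. \<tau> *\<^sub>R block_op a G D \<delta> u))"
    using poly_op_block_op_bij[OF assms(1-3), of "1/4" "1/48"] by simp
qed

end

theory Submission
  imports Defs
begin

text \<open>The operator \<open>A = block_op a G D \<delta>\<close> is self-adjoint for the form \<open>sym_form\<close>, which by
  \<open>4 a \<delta>\<^sub>0 \<sigma>\<^sup>2 < 1\<close> is equivalent to the inner product uniformly in \<open>\<delta>\<close>, and its eigenvalues are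
  nonpositive. By the spectral theorem for that form it suffices to bound \<open>R(-x)^n - exp(-nx)\<close> by a
  multiple of \<open>n^-4 \<le> (\<Delta>t / t\<^sub>0)^4\<close> uniformly in \<open>x \<ge> 0\<close>, stiff and nonstiff modes alike. For
  \<open>x \<le> 1\<close> this is the order \<open>R(-x) = exp(-x) + O(x^5)\<close> together with \<open>\<bar>R(-x)\<bar> \<le> exp(-qx)\<close>;
  for \<open>x \<ge> 1\<close> both powers decay geometrically in \<open>n\<close>.\<close>

section \<open>Operators self-adjoint for a bilinear form\<close>

locale self_adjoint_form =
  fixes B :: "'v::euclidean_space \<Rightarrow> 'v \<Rightarrow> real" and A :: "'v \<Rightarrow> 'v"
  assumes bilin: "bilinear B"
    and sym: "B u v = B v u"
    and pos: "u \<noteq> 0 \<Longrightarrow> B u u > 0"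
    and lin: "linear A"
    and self_adjoint: "B (A u) v = B u (A v)"
begin

lemmas B_simps = bilinear_ladd[OF bilin] bilinear_radd[OF bilin] bilinear_lsub[OF bilin]
  bilinear_rsub[OF bilin] bilinear_lmul[OF bilin] bilinear_rmul[OF bilin]
  bilinear_lzero[OF bilin] bilinear_rzero[OF bilin]

lemma B_nonneg: "B u u \<ge> 0"
  using pos[of u] by (cases "u = 0") (auto simp: B_simps)

text \<open>A maximizer of the Rayleigh quotient over the compact unit sphere of \<open>W\<close> is
  an eigenvector, by the first-order condition at a maximum.\<close>

lemma maximal_eigenvector:
  assumes W: "subspace W" and inv: "\<And>u. u \<in> W \<Longrightarrow> A u \<in> W" and w: "w \<in> W" "w \<noteq> 0"
  obtains v \<mu> where "v \<in> W" "v \<noteq> 0" "A v = \<mu> *\<^sub>R v" "\<And>u. u \<in> W \<Longrightarrow> B (A u) u \<le> \<mu> * B u u"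
proof -
  define Q where "Q = (\<lambda>u. B (A u) u / B u u)"
  define S where "S = W \<inter> sphere 0 1"
  have bb: "bounded_bilinear B"
    using bilin by (simp add: bilinear_conv_bounded_bilinear)
  have "continuous_on S A"
    using lin linear_continuous_on linear_conv_bounded_linear by blast
  moreover have "B u u \<noteq> 0" if "u \<in> S" for u
    using pos[of u] that by (cases "u = 0") (auto simp: S_def)
  ultimately have "continuous_on S Q"
    unfolding Q_def
    by (intro continuous_intros bounded_bilinear.continuous_on[OF bb]) auto
  moreover have "compact S"
    unfolding S_def using closed_subspace[OF W] by (intro closed_Int_compact) auto
  moreover have "(1 / norm w) *\<^sub>R w \<in> S"
    using w by (auto simp: S_def intro: subspace_scale[OF W])
  ultimately obtain v where v: "v \<in> S" and max: "\<And>u. u \<in> S \<Longrightarrow> Q u \<le> Q v"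
    using continuous_attains_sup[of S Q] by blast
  have v0: "v \<noteq> 0" "v \<in> W" using v by (auto simp: S_def)
  have le: "B (A u) u \<le> Q v * B u u" if "u \<in> W" for u
  proof (cases "u = 0")
    case False
    define c where "c = 1 / norm u"
    have c: "c \<noteq> 0" using False by (simp add: c_def)
    have "c *\<^sub>R u \<in> S"
      using False that by (auto simp: S_def c_def intro: subspace_scale[OF W])
    then have "Q (c *\<^sub>R u) \<le> Q v" by (rule max)
    moreover have "Q (c *\<^sub>R u) = Q u"
      using c by (simp add: Q_def B_simps linear_cmul[OF lin])
    ultimately show ?thesis
      using pos[OF False] by (simp add: Q_def pos_divide_le_eq)
  qed (simp add: B_simps)
  \<comment> \<open>\<open>P\<close> is positive semidefinite on \<open>W\<close> and \<open>P v v = 0\<close>, so \<open>v\<close> lies in its radical.\<close>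
  define P where "P = (\<lambda>u w. Q v * B u w - B (A u) w)"
  have P_nonneg: "P u u \<ge> 0" if "u \<in> W" for u
    using le[OF that] by (simp add: P_def)
  have "P v v = 0"
    using pos[OF v0(1)] by (simp add: P_def Q_def)
  have radical: "P v u = 0" if u: "u \<in> W" for u
  proof (rule ccontr)
    assume nz: "P v u \<noteq> 0"
    have expand: "P (v + t *\<^sub>R u) (v + t *\<^sub>R u) = t * (2 * P v u + t * P u u)" for t
    proof -
      have "P u v = P v u"
        using self_adjoint[of u v] sym[of u v] sym[of u "A v"] by (simp add: P_def)
      moreover have "P (v + t *\<^sub>R u) (v + t *\<^sub>R u) = P v v + t * P v u + t * P u v + t * (t * P u u)"
        by (simp add: P_def B_simps linear_add[OF lin] linear_cmul[OF lin] algebra_simps)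
      ultimately show ?thesis
        using \<open>P v v = 0\<close> by (simp add: algebra_simps)
    qed
    have nonneg: "t * (2 * P v u + t * P u u) \<ge> 0" for t
      unfolding expand[symmetric] using u v0
      by (intro P_nonneg subspace_add[OF W] subspace_scale[OF W])
    \<comment> \<open>The \<open>+ 1\<close> keeps the denominator positive even when
      \<open>P u u = 0\<close>. At this \<open>t\<close> the quadratic equals
      \<open>- (t\<^sup>2 * (P u u + 2))\<close>, which is negative.\<close>
    define t where "t = - P v u / (P u u + 1)"
    have d: "P u u + 1 > 0" using P_nonneg[OF u] by simp
    have eq: "t * (P u u + 1) = - P v u" using d by (simp add: t_def)
    have "2 * P v u + t * P u u = - (t * (P u u + 2))" using eq by (simp add: algebra_simps)
    then have "t * (2 * P v u + t * P u u) = - (t\<^sup>2 * (P u u + 2))"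
      by (simp only:) (simp add: power2_eq_square)
    moreover have "t\<^sup>2 * (P u u + 2) > 0"
      using nz d by (simp add: t_def)
    ultimately show False using nonneg[of t] by simp
  qed
  \<comment> \<open>The residual represents the functional \<open>P v\<close> through
    \<open>B\<close>, and \<open>P v\<close> vanishes on \<open>W\<close>. Testing with
    \<open>r\<close> itself gives \<open>B r r = 0\<close>.\<close>
  define r where "r = Q v *\<^sub>R v - A v"
  have "r \<in> W" unfolding r_def using v0 inv by (intro subspace_diff[OF W] subspace_scale[OF W]) auto
  moreover have "B r w = P v w" for w by (simp add: r_def P_def B_simps)
  ultimately have "B r r = 0" using radical[of r] by simp
  then have "r = 0" using pos[of r] by auto
  then show thesis using that[of v "Q v"] v0 le by (simp add: r_def)
qed

text \<open>Induction on the dimension: an eigenvector is split off, and its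
  \<open>B\<close>-orthogonal complement in \<open>W\<close> is again invariant because
  \<open>A\<close> is self-adjoint for \<open>B\<close>.\<close>

lemma eigenbasis_subspace:
  assumes "subspace W" and "\<And>u. u \<in> W \<Longrightarrow> A u \<in> W"
  shows "\<exists>E. finite E \<and> W = span E \<and> (\<forall>e\<in>E. \<exists>\<mu>. A e = \<mu> *\<^sub>R e) \<and>
           (\<forall>e\<in>E. e \<noteq> 0) \<and> (\<forall>e\<in>E. \<forall>f\<in>E. e \<noteq> f \<longrightarrow> B e f = 0)"
  using assms
proof (induction "dim W" arbitrary: W rule: less_induct)
  case less
  note W = less.prems(1)
  show ?case
  proof (cases "W = {0}")
    case True
    then show ?thesis by (intro exI[of _ "{}"]) auto
  next
    case False
    then obtain w where "w \<in> W" "w \<noteq> 0" using subspace_0[OF W] by blast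
    then obtain v \<mu> where v: "v \<in> W" "v \<noteq> 0" "A v = \<mu> *\<^sub>R v"
      using maximal_eigenvector[OF W less.prems(2)] by blast
    define W' where "W' = {u \<in> W. B u v = 0}"
    have sub: "subspace W'"
      unfolding W'_def using W
      by (auto simp: subspace_def B_simps)
    have inv: "A u \<in> W'" if "u \<in> W'" for u
      using that less.prems(2) by (auto simp: W'_def self_adjoint v B_simps)
    have "v \<notin> W'" using pos[OF v(2)] by (simp add: W'_def)
    then have "W' \<subset> W" using v by (auto simp: W'_def)
    then have "dim W' < dim W"
      using sub W by (metis dim_psubset span_eq_iff)
    from less.hyps[OF this sub inv] obtain E where
      E: "finite E" "W' = span E" "\<forall>e\<in>E. \<exists>\<mu>. A e = \<mu> *\<^sub>R e" "\<forall>e\<in>E. e \<noteq> 0"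
        "\<forall>e\<in>E. \<forall>f\<in>E. e \<noteq> f \<longrightarrow> B e f = 0"
      by blast
    have EW: "E \<subseteq> W'" using E(2) span_superset by blast
    have "W = span (insert v E)"
    proof
      show "span (insert v E) \<subseteq> W"
        using EW v by (intro span_minimal W) (auto simp: W'_def)
      show "W \<subseteq> span (insert v E)"
      proof
        fix u assume u: "u \<in> W"
        \<comment> \<open>Coefficient of the \<open>B\<close>-orthogonal projection of
          \<open>u\<close> onto \<open>v\<close>.\<close>
        define c where "c = B u v / B v v"
        have "B (u - c *\<^sub>R v) v = 0"
          using pos[OF v(2)] by (simp add: c_def B_simps)
        then have "u - c *\<^sub>R v \<in> W'"
          using u v by (auto simp: W'_def intro: subspace_diff[OF W] subspace_scale[OF W])
        then show "u \<in> span (insert v E)"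
          using E(2) by (auto simp: span_insert)
      qed
    qed
    moreover have "B e v = 0 \<and> B v e = 0" if "e \<in> E" for e
      using that EW sym[of v e] by (auto simp: W'_def)
    ultimately show ?thesis
      using E v by (intro exI[of _ "insert v E"]) auto
  qed
qed

lemma eigenbasis:
  obtains E \<mu> where "finite E" "span E = UNIV" "\<And>e. e \<in> E \<Longrightarrow> A e = \<mu> e *\<^sub>R e"
    "\<And>e. e \<in> E \<Longrightarrow> e \<noteq> 0" "\<And>e f. e \<in> E \<Longrightarrow> f \<in> E \<Longrightarrow> e \<noteq> f \<Longrightarrow> B e f = 0"
proof -
  obtain E where E: "finite E" "UNIV = span E" "\<forall>e\<in>E. \<exists>\<mu>. A e = \<mu> *\<^sub>R e"
      "\<forall>e\<in>E. e \<noteq> 0" "\<forall>e\<in>E. \<forall>f\<in>E. e \<noteq> f \<longrightarrow> B e f = 0"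
    using eigenbasis_subspace[of UNIV] by auto
  obtain \<mu> where "\<forall>e\<in>E. A e = \<mu> e *\<^sub>R e"
    using bchoice[OF E(3)] by blast
  then show thesis using E that[of E \<mu>] by auto
qed

lemma form_orthogonal_sum:
  assumes "finite E" and "\<And>e f. e \<in> E \<Longrightarrow> f \<in> E \<Longrightarrow> e \<noteq> f \<Longrightarrow> B e f = 0"
  shows "B (\<Sum>e\<in>E. c e *\<^sub>R e) (\<Sum>e\<in>E. c e *\<^sub>R e) = (\<Sum>e\<in>E. (c e)\<^sup>2 * B e e)"
proof -
  have "B (\<Sum>e\<in>E. c e *\<^sub>R e) (\<Sum>e\<in>E. c e *\<^sub>R e) = (\<Sum>(e, f)\<in>E \<times> E. c e * c f * B e f)"
    by (subst bilinear_sum[OF bilin]) (simp add: B_simps mult.assoc mult.left_commute)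
  also have "\<dots> = (\<Sum>e\<in>E. \<Sum>f\<in>E. c e * c f * B e f)"
    by (rule sum.cartesian_product[symmetric])
  also have "\<dots> = (\<Sum>e\<in>E. \<Sum>f\<in>E. if f = e then (c e)\<^sup>2 * B e e else 0)"
    using assms(2) by (intro sum.cong refl) (auto simp: power2_eq_square)
  finally show ?thesis using assms(1) by simp
qed

text \<open>Cross terms vanish, so each squared coefficient is scaled separately. This turns a
  scalar bound at the eigenvalues into a bound in the norm given by \<open>B\<close>.\<close>

lemma form_orthogonal_sum_le:
  assumes "finite E" and "\<And>e f. e \<in> E \<Longrightarrow> f \<in> E \<Longrightarrow> e \<noteq> f \<Longrightarrow> B e f = 0"
    and "\<And>e. e \<in> E \<Longrightarrow> \<bar>g e\<bar> \<le> \<epsilon>"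
  shows "B (\<Sum>e\<in>E. (g e * c e) *\<^sub>R e) (\<Sum>e\<in>E. (g e * c e) *\<^sub>R e)
           \<le> \<epsilon>\<^sup>2 * B (\<Sum>e\<in>E. c e *\<^sub>R e) (\<Sum>e\<in>E. c e *\<^sub>R e)"
proof -
  have "(g e * c e)\<^sup>2 * B e e \<le> \<epsilon>\<^sup>2 * ((c e)\<^sup>2 * B e e)" if "e \<in> E" for e
  proof -
    have "(g e)\<^sup>2 \<le> \<epsilon>\<^sup>2" using assms(3)[OF that] by (metis abs_ge_zero power2_abs power_mono)
    then have "(g e)\<^sup>2 * ((c e)\<^sup>2 * B e e) \<le> \<epsilon>\<^sup>2 * ((c e)\<^sup>2 * B e e)"
      using B_nonneg by (intro mult_right_mono) auto
    then show ?thesis by (simp add: power_mult_distrib mult.assoc)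
  qed
  then have "(\<Sum>e\<in>E. (g e * c e)\<^sup>2 * B e e) \<le> \<epsilon>\<^sup>2 * (\<Sum>e\<in>E. (c e)\<^sup>2 * B e e)"
    unfolding sum_distrib_left by (rule sum_mono)
  then show ?thesis
    using form_orthogonal_sum[OF assms(1,2)] by simp
qed

end

section \<open>Singular values and the operator norm\<close>

text \<open>Eigenvectors of \<open>adjoint G (G x)\<close> for distinct \<open>s\<^sup>2\<close> are
  orthogonal, hence independent, so finite dimension allows only finitely many. This makes the
  \<open>Max\<close> in \<open>sigma_max\<close> meaningful.\<close>

lemma finite_singular_values:
  fixes G :: "'x::euclidean_space \<Rightarrow> 'q::euclidean_space"
  assumes G: "linear G"
  shows "finite {s. singular_value G s}"
proof -
  have "\<forall>s\<in>{s. singular_value G s}. \<exists>x. x \<noteq> 0 \<and> adjoint G (G x) = s\<^sup>2 *\<^sub>R x"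
    by (auto simp: singular_value_def)
  then obtain e where e: "\<And>s. singular_value G s \<Longrightarrow> e s \<noteq> 0 \<and> adjoint G (G (e s)) = s\<^sup>2 *\<^sub>R e s"
    using bchoice[of "{s. singular_value G s}"] by (metis mem_Collect_eq)
  have orth: "e s \<bullet> e t = 0" if s: "singular_value G s" and t: "singular_value G t" and "s \<noteq> t" for s t
  proof -
    have "s\<^sup>2 * (e s \<bullet> e t) = adjoint G (G (e s)) \<bullet> e t" using e[OF s] by simp
    also have "\<dots> = e s \<bullet> adjoint G (G (e t))"
      using adjoint_works[OF G, of "e t" "G (e s)"] adjoint_works[OF G, of "e s" "G (e t)"]
      by (simp add: inner_commute)
    also have "\<dots> = t\<^sup>2 * (e s \<bullet> e t)" using e[OF t] by simp
    finally have "s\<^sup>2 = t\<^sup>2 \<or> e s \<bullet> e t = 0" by auto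
    moreover have "s\<^sup>2 \<noteq> t\<^sup>2" using s t \<open>s \<noteq> t\<close> by (simp add: singular_value_def)
    ultimately show ?thesis by simp
  qed
  let ?S = "{s. singular_value G s}"
  have inj: "inj_on e ?S"
    using orth e by (metis (mono_tags, lifting) inj_onI inner_eq_zero_iff mem_Collect_eq)
  have "pairwise orthogonal (e ` ?S)"
    using orth by (auto simp: pairwise_def orthogonal_def)
  moreover have "0 \<notin> e ` ?S" using e by fastforce
  ultimately have "finite (e ` ?S)"
    using pairwise_orthogonal_independent independent_imp_finite by blast
  then show ?thesis using inj finite_imageD by blast
qed

lemma sigma_max_nonneg:
  fixes G :: "'x::euclidean_space \<Rightarrow> 'q::euclidean_space"
  assumes "linear G"
  shows "sigma_max G \<ge> 0"
  unfolding sigma_max_def using finite_singular_values[OF assms] by (intro Max_ge) auto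

text \<open>The largest eigenvalue of \<open>x \<mapsto> adjoint G (G x)\<close> bounds the squared
  ratio of \<open>norm (G x)\<close> to \<open>norm x\<close>, and its square root is a singular
  value.\<close>

lemma norm_le_sigma_max:
  fixes G :: "'x::euclidean_space \<Rightarrow> 'q::euclidean_space"
  assumes G: "linear G"
  shows "norm (G x) \<le> sigma_max G * norm x"
proof -
  define A where "A = (\<lambda>x. adjoint G (G x))"
  have A: "A u \<bullet> v = G u \<bullet> G v" "u \<bullet> A v = G u \<bullet> G v" for u v
    using adjoint_works[OF G] by (simp_all add: A_def inner_commute)
  interpret self_adjoint_form "(\<bullet>)" A
  proof (rule self_adjoint_form.intro)
    show "bilinear ((\<bullet>) :: 'x \<Rightarrow> 'x \<Rightarrow> real)"
      using bilinear_conv_bounded_bilinear bounded_bilinear_inner by blast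
    show "linear A"
      using linear_compose[OF G adjoint_linear[OF G]] by (simp add: A_def o_def)
    show "u \<bullet> v = v \<bullet> u" for u v :: 'x by (rule inner_commute)
    show "A u \<bullet> v = u \<bullet> A v" for u v by (simp add: A)
  qed simp
  obtain w :: 'x where "w \<noteq> 0" using nonzero_Basis nonempty_Basis by blast
  then obtain v \<mu> where v: "v \<noteq> 0" "A v = \<mu> *\<^sub>R v" and le: "\<And>u. A u \<bullet> u \<le> \<mu> * (u \<bullet> u)"
    using maximal_eigenvector[of UNIV w] by auto
  have "G v \<bullet> G v = \<mu> * (v \<bullet> v)" using v A(1)[of v v] by simp
  then have "\<mu> * (v \<bullet> v) \<ge> 0" by (metis inner_ge_zero)
  then have \<mu>: "\<mu> \<ge> 0" by (meson inner_gt_zero_iff mult_neg_pos not_less v(1))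
  then have "singular_value G (sqrt \<mu>)"
    using v by (auto simp: singular_value_def A_def)
  \<comment> \<open>If \<open>sqrt \<mu> = 0\<close>, the \<open>0\<close> inserted in
    \<open>sigma_max\<close> provides the bound.\<close>
  then have "sqrt \<mu> \<le> sigma_max G"
    unfolding sigma_max_def using finite_singular_values[OF G] by (cases "sqrt \<mu> = 0") (auto intro!: Max_ge)
  have "(norm (G x))\<^sup>2 \<le> \<mu> * (norm x)\<^sup>2"
    using le[of x] by (simp add: A power2_norm_eq_inner)
  then have "(norm (G x))\<^sup>2 \<le> (sqrt \<mu> * norm x)\<^sup>2"
    using \<mu> by (simp add: power_mult_distrib)
  then have "norm (G x) \<le> sqrt \<mu> * norm x"
    by (rule power2_le_imp_le) (use \<mu> in simp)
  also have "\<dots> \<le> sigma_max G * norm x"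
    using \<open>sqrt \<mu> \<le> sigma_max G\<close> by (intro mult_right_mono) auto
  finally show ?thesis .
qed

section \<open>The rational function on the negative half-line\<close>

text \<open>Together with \<open>R_den\<close> this writes R(-x) as a single fraction.
  \<open>R_den\<close> is the product of both denominators at -x; in the numerator the quartic terms
  cancel, so R(-x) tends to 0 at infinity.\<close>

definition R_num :: "real \<Rightarrow> real \<Rightarrow> real" where
  "R_num C x = 1 - (7/12 - 13/2 * C) * x + (7/48 - 27/8 * C) * x^2 - (5/288 - 61/96 * C) * x^3"

definition R_den :: "real \<Rightarrow> real \<Rightarrow> real" where
  "R_den C x = 1 + (5/12 + 13/2 * C) * x + (1/16 + 25/8 * C) * x^2 + (1/288 + 49/96 * C) * x^3 + C/32 * x^4"

definition R_real :: "real \<Rightarrow> real \<Rightarrow> real" where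
  "R_real C z = (poly [:1, coeff_a0 C, C:] z
      + poly [:0, coeff_a1 C, - C:] z * (poly [:1, 1/4, 1/48:] z / poly [:1, -1/4, 1/48:] z))
      / poly [:1, - coeff_a2 C, 3/2 * C:] z"

text \<open>Rational bounds replace the square root. At \<open>1/78\<close> the coefficient
  \<open>13/2 * C - 1/12\<close> of \<open>R_den - R_num\<close> changes sign, as does
  \<open>13 * C - 1/6\<close> in \<open>R_den + R_num\<close>.\<close>

lemma C_bounds:
  assumes "C \<in> {C_minus..C_plus}"
  shows "1/78 < C" "C < 1/20"
proof -
  have "sqrt 105 < 14" by (rule real_less_lsqrt) auto
  then show "1/78 < C" "C < 1/20"
    using assms by (auto simp: C_minus_def C_plus_def)
qed

text \<open>A quartic denominator times a truncated exponential, arranged so that the order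
  conditions appear as coefficients up to \<open>x^4\<close> and the rest as a multiple of
  \<open>x^5\<close>.\<close>

lemma quartic_product:
  fixes x :: "'a::comm_ring_1"
  shows "(1 + d1 * x + d2 * x^2 + d3 * x^3 + d4 * x^4) * (1 - x + p2 * x^2 - p3 * x^3 + p4 * x^4)
    = 1 + (d1 - 1) * x + (d2 - d1 + p2) * x^2 + (d3 - d2 + d1 * p2 - p3) * x^3
      + (d4 - d3 + d2 * p2 - d1 * p3 + p4) * x^4
      + x^5 * ((d1 * p4 - d2 * p3 + d3 * p2 - d4) + (d4 * p2 - d3 * p3 + d2 * p4) * x
        + (d3 * p4 - d4 * p3) * x^2 + d4 * p4 * x^3)"
  by (simp add: algebra_simps eval_nat_numeral)

context
  fixes C x :: real
  assumes C: "1/78 < C" "C < 1/20" and x: "x \<ge> 0"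
begin

lemma H_den_pos: "poly [:1, -1/4, 1/48:] (- x) > 0"
proof -
  have "poly [:1, -1/4, 1/48:] (- x) = 1 + x/4 + x^2/48"
    by (simp add: power2_eq_square algebra_simps)
  then show ?thesis using x by (simp add: add_pos_nonneg)
qed

lemma R_den2_pos: "poly [:1, - coeff_a2 C, 3/2 * C:] (- x) > 0"
  using x C by (simp add: coeff_a2_def add_pos_nonneg algebra_simps)

lemma R_den_ge_1: "R_den C x \<ge> 1"
  using x C by (simp add: R_den_def)

lemma R_real_eq: "R_real C (- x) = R_num C x / R_den C x"
proof -
  have "poly [:1, - coeff_a2 C, 3/2 * C:] (- x) * poly [:1, -1/4, 1/48:] (- x) = R_den C x"
    by (simp add: R_den_def coeff_a2_def field_simps power2_eq_square power3_eq_cube power4_eq_xxxx)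
  moreover have "poly [:1, coeff_a0 C, C:] (- x) * poly [:1, -1/4, 1/48:] (- x)
      + poly [:0, coeff_a1 C, - C:] (- x) * poly [:1, 1/4, 1/48:] (- x) = R_num C x"
    by (simp add: R_num_def coeff_a0_def coeff_a1_def field_simps power2_eq_square power3_eq_cube
        power4_eq_xxxx)
  moreover have "(p + q * (r / h)) / d = (p * h + q * r) / (d * h)" if "h \<noteq> 0" for p q r d h :: real
    using that by (simp add: field_simps)
  ultimately show ?thesis
    unfolding R_real_def using H_den_pos by (metis less_irrefl)
qed

text \<open>A crude majorant free of \<open>C\<close>, so that the comparisons below are between
  fixed polynomials.\<close>

lemma R_den_le: "R_den C x \<le> 1 + x + x^2 + x^3/10 + x^4/100"
  unfolding R_den_def
proof (intro add_mono order_refl)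
  show "(5/12 + 13/2 * C) * x \<le> x" using C x mult_right_mono[of "5/12 + 13/2 * C" 1 x] by simp
  show "(1/16 + 25/8 * C) * x^2 \<le> x^2" using C mult_right_mono[of "1/16 + 25/8 * C" 1 "x^2"] by simp
  show "(1/288 + 49/96 * C) * x^3 \<le> x^3/10"
    using C x mult_right_mono[of "1/288 + 49/96 * C" "1/10" "x^3"] by simp
  show "C/32 * x^4 \<le> x^4/100" using C mult_right_mono[of "C/32" "1/100" "x^4"] by simp
qed

text \<open>Upper half of the damping estimate: R(-x) stays below \<open>1 - min 1 x / 1000\<close>.
  The linear term of the difference gives the rate for small \<open>x\<close>; its quartic term
  matches the degree of \<open>R_den\<close> for large \<open>x\<close>.\<close>

lemma R_den_minus_num: "min 1 x * R_den C x \<le> 1000 * (R_den C x - R_num C x)"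
proof -
  have diff: "R_den C x - R_num C x = x + (13/2 * C - 1/12) * x^2 + (1/48 - C/8) * x^3 + C/32 * x^4"
    by (simp add: R_den_def R_num_def algebra_simps)
  \<comment> \<open>The constant \<open>1/2496\<close> is \<open>C/32\<close> at
    \<open>C = 1/78\<close>.\<close>
  have "x + x^3/100 + x^4/2496 \<le> R_den C x - R_num C x"
  proof -
    have "0 \<le> (13/2 * C - 1/12) * x^2" using C by simp
    moreover have "1/100 * x^3 \<le> (1/48 - C/8) * x^3" using C x by (intro mult_right_mono) auto
    moreover have "1/2496 * x^4 \<le> C/32 * x^4" using C x by (intro mult_right_mono) auto
    ultimately show ?thesis unfolding diff by linarith
  qed
  moreover have "min 1 x * R_den C x \<le> 10 * x + 9 * x^3 + x^4/10"
  proof -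
    note D = R_den_le
    show ?thesis
    proof (cases "x \<le> 1")
      case True
      have p: "x^2 \<le> 1" "x^3 \<le> 1" "x^4 \<le> 1" using x True by (auto intro: power_le_one)
      have "min 1 x * R_den C x \<le> x * 10"
        using True x D p by (simp add: mult_left_mono)
      moreover have "x^3 \<ge> 0" "x^4 \<ge> 0" using x by auto
      ultimately show ?thesis by linarith
    next
      case False
      have "x^2 \<le> x^3" using False by (intro power_increasing) auto
      moreover have "x^3 \<ge> 0" "x^4 \<ge> 0" using x by auto
      moreover have "min 1 x * R_den C x = R_den C x" using False by simp
      ultimately show ?thesis using False D by linarith
    qed
  qed
  moreover have "x^3 \<ge> 0" "x^4 \<ge> 0" using x by auto
  ultimately show ?thesis using x by argo
qed

text \<open>Lower half of the damping estimate, keeping R(-x) away from -1. The constant term 2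
  makes \<open>min 1 x \<le> 1\<close> sufficient here.\<close>

lemma R_den_plus_num: "min 1 x * R_den C x \<le> 1000 * (R_den C x + R_num C x)"
proof -
  have sum: "R_den C x + R_num C x = 2 + (13 * C - 1/6) * x + (5/24 - C/4) * x^2
      + (110/96 * C - 1/72) * x^3 + C/32 * x^4"
    by (simp add: R_den_def R_num_def algebra_simps)
  have "2 + x^2/10 + x^4/2496 \<le> R_den C x + R_num C x"
  proof -
    have "0 \<le> (13 * C - 1/6) * x" "0 \<le> (110/96 * C - 1/72) * x^3" using C x by auto
    moreover have "1/10 * x^2 \<le> (5/24 - C/4) * x^2" using C x by (intro mult_right_mono) auto
    moreover have "1/2496 * x^4 \<le> C/32 * x^4" using C x by (intro mult_right_mono) auto
    ultimately show ?thesis unfolding sum by linarith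
  qed
  moreover have "min 1 x * R_den C x \<le> R_den C x"
    using R_den_ge_1 x by (simp add: mult_le_cancel_right1)
  moreover note R_den_le
  \<comment> \<open>The odd powers in the majorant of \<open>R_den\<close> are absorbed by the
    neighbouring even ones, which the lower bound of the sum contains.\<close>
  moreover have "x \<le> 1 + x^2"
    using zero_le_power2[of "x - 1"] x by (simp add: power2_eq_square algebra_simps)
  moreover have "x^3 \<le> x^2 + x^4"
  proof -
    have "0 \<le> x^2 * ((x - 1)^2 + x)" using x by simp
    also have "\<dots> = x^2 + x^4 - x^3" by (simp add: power2_eq_square power3_eq_cube power4_eq_xxxx algebra_simps)
    finally show ?thesis by simp
  qed
  moreover have "x^4 \<ge> 0" "x^2 \<ge> 0" by auto
  ultimately show ?thesis by argo
qed

text \<open>Both halves combine to \<open>1 - min 1 x / 1000\<close>; the exponential form makes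
  taking powers a multiplication in the exponent.\<close>

lemma abs_R_real_le: "\<bar>R_real C (- x)\<bar> \<le> exp (- (min 1 x / 1000))"
proof -
  have D: "R_den C x > 0" using R_den_ge_1 by simp
  have "\<bar>R_num C x\<bar> \<le> (1 - min 1 x / 1000) * R_den C x"
    using R_den_minus_num R_den_plus_num by (simp add: abs_le_iff algebra_simps)
  then have "\<bar>R_real C (- x)\<bar> \<le> 1 - min 1 x / 1000"
    using D by (simp add: R_real_eq abs_divide pos_divide_le_eq)
  also have "\<dots> \<le> exp (- (min 1 x / 1000))"
    using exp_ge_add_one_self[of "- (min 1 x / 1000)"] by simp
  finally show ?thesis .
qed

text \<open>For every \<open>C\<close>, \<open>R_den\<close> times the degree 4 Taylor polynomial of
  \<open>exp (- x)\<close> matches \<open>R_num\<close> through \<open>x^4\<close>. What remains is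
  the Taylor remainder and a multiple of \<open>x^5\<close>, divided by \<open>R_den\<close>, which
  is at least 1.\<close>

lemma R_real_order:
  assumes "x \<le> 1"
  shows "\<bar>R_real C (- x) - exp (- x)\<bar> \<le> 10 * x^5"
proof -
  define r where "r = exp (- x) - (1 - x + 1/2 * x^2 - 1/6 * x^3 + 1/24 * x^4)"
  have r: "\<bar>r\<bar> \<le> x^5"
  proof -
    obtain t where t: "\<bar>t\<bar> \<le> \<bar>- x\<bar>"
      and e: "exp (- x) = (\<Sum>m<5. (- x) ^ m / fact m) + exp t / fact 5 * (- x) ^ 5"
      using Maclaurin_exp_le[of "- x" 5] by blast
    have eq: "r = - (exp t / 120 * x^5)"
      unfolding r_def e by (simp add: eval_nat_numeral fact_numeral)
    have "exp t \<le> exp 1" using t assms x by simp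
    also have "\<dots> \<le> 3" by (rule exp_le)
    finally have "exp t / 120 * x^5 \<le> 1 * x^5" using x by (intro mult_right_mono) auto
    then show ?thesis unfolding eq using x by simp
  qed
  define d1 d2 d3 d4 where d: "d1 = 5/12 + 13/2 * C" "d2 = 1/16 + 25/8 * C"
    "d3 = 1/288 + 49/96 * C" "d4 = C/32"
  \<comment> \<open>The cofactor of \<open>x^5\<close> in \<open>quartic_product\<close> for the
    exponential coefficients 1/2, 1/6, 1/24.\<close>
  define s where "s = (d1/24 - d2/6 + d3/2 - d4) + (d4/2 - d3/6 + d2/24) * x
    + (d3/24 - d4/6) * x^2 + d4/24 * x^3"
  have p: "x^2 \<le> 1" "x^3 \<le> 1" "x^4 \<le> 1" using x assms by (auto intro: power_le_one)
  have D: "R_den C x \<le> 4" using R_den_le p assms by simp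
  have s: "\<bar>s\<bar> \<le> 1"
  proof -
    have *: "\<bar>c * y\<bar> \<le> 1/4" if "\<bar>c\<bar> \<le> 1/4" "0 \<le> y" "y \<le> 1" for c y :: real
      using mult_mono[OF that(1,3)] that by (simp add: abs_mult)
    have "0 \<le> d1" "d1 \<le> 1" "0 \<le> d2" "d2 \<le> 1/2" "0 \<le> d3" "d3 \<le> 1/10" "0 \<le> d4" "d4 \<le> 1/10"
      using C unfolding d by simp_all
    then have c: "\<bar>d1/24 - d2/6 + d3/2 - d4\<bar> \<le> 1/4" "\<bar>d4/2 - d3/6 + d2/24\<bar> \<le> 1/4"
        "\<bar>d3/24 - d4/6\<bar> \<le> 1/4" "\<bar>d4/24\<bar> \<le> 1/4"
      by linarith+
    have "\<bar>(d4/2 - d3/6 + d2/24) * x\<bar> \<le> 1/4"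
      using x assms by (rule *[OF c(2)])
    moreover have "\<bar>(d3/24 - d4/6) * x^2\<bar> \<le> 1/4"
      using p by (intro *[OF c(3)]) auto
    moreover have "\<bar>d4/24 * x^3\<bar> \<le> 1/4"
      using p x by (intro *[OF c(4)]) auto
    ultimately show ?thesis using c(1) unfolding s_def by linarith
  qed
  have "R_den C x * (1 - x + 1/2 * x^2 - 1/6 * x^3 + 1/24 * x^4) = R_num C x + x^5 * s"
  proof -
    have den: "R_den C x = 1 + d1 * x + d2 * x^2 + d3 * x^3 + d4 * x^4"
      by (simp add: R_den_def d)
    \<comment> \<open>the conditions for order 4: the coefficients of \<open>1, x, \<dots>, x^4\<close> agree\<close>
    have coeffs: "d1 - 1 = - (7/12 - 13/2 * C)" "d2 - d1 + 1/2 = 7/48 - 27/8 * C"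
        "d3 - d2 + d1 * (1/2) - 1/6 = - (5/288 - 61/96 * C)"
        "d4 - d3 + d2 * (1/2) - d1 * (1/6) + 1/24 = 0"
      by (simp_all add: d field_simps)
    show ?thesis
      unfolding den quartic_product coeffs R_num_def s_def by simp (simp add: algebra_simps)
  qed
  moreover have "R_den C x * exp (- x)
      = R_den C x * (1 - x + 1/2 * x^2 - 1/6 * x^3 + 1/24 * x^4) + R_den C x * r"
    by (simp add: r_def flip: distrib_left)
  ultimately have "R_num C x - R_den C x * exp (- x) = - (R_den C x * r + x^5 * s)"
    by linarith
  also have "\<bar>\<dots>\<bar> \<le> 4 * x^5 + x^5 * 1"
  proof -
    have "\<bar>R_den C x * r\<bar> \<le> 4 * x^5"
      using D R_den_ge_1 r x by (simp add: abs_mult mult_mono)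
    moreover have "\<bar>x^5 * s\<bar> \<le> x^5 * 1"
      using mult_left_mono[OF s, of "x^5"] x by (simp add: abs_mult)
    ultimately show ?thesis by linarith
  qed
  finally have N: "\<bar>R_num C x - R_den C x * exp (- x)\<bar> \<le> 5 * x^5" by simp
  have "R_real C (- x) - exp (- x) = (R_num C x - R_den C x * exp (- x)) / R_den C x"
    using R_den_ge_1 by (simp add: R_real_eq diff_divide_distrib)
  then have "\<bar>R_real C (- x) - exp (- x)\<bar> \<le> \<bar>R_num C x - R_den C x * exp (- x)\<bar> / 1"
    using R_den_ge_1 by (simp only: abs_divide) (intro divide_left_mono, auto)
  then show ?thesis using N by simp
qed

end

section \<open>Errors of powers on the negative half-line\<close>

text \<open>A single term of the exponential series is at most the whole sum.\<close>

lemma pow_le_fact_exp: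
  assumes "(y::real) \<ge> 0"
  shows "y ^ k \<le> fact k * exp y"
proof -
  have "y ^ k /\<^sub>R fact k \<le> (\<Sum>j. y ^ j /\<^sub>R fact j)"
    using sum_le_suminf[OF summable_exp_generic[of y], of "{k}"] assms by simp
  then show ?thesis by (simp add: exp_def divide_simps mult.commute)
qed

text \<open>Telescoping of local errors: \<open>a ^ n - b ^ n\<close> has the factor
  \<open>a - b\<close>, and each of the \<open>n\<close> terms of its cofactor is a product of
  \<open>n - 1\<close> factors bounded by \<open>m\<close>.\<close>

lemma abs_power_diff_le:
  fixes a b m :: real
  assumes "\<bar>a\<bar> \<le> m" "\<bar>b\<bar> \<le> m"
  shows "\<bar>a ^ n - b ^ n\<bar> \<le> real n * \<bar>a - b\<bar> * m ^ (n - 1)"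
proof -
  have "m \<ge> 0" using assms by linarith
  have "\<bar>a ^ n - b ^ n\<bar> = \<bar>a - b\<bar> * \<bar>\<Sum>i<n. b ^ (n - Suc i) * a ^ i\<bar>"
    by (simp add: power_diff_sumr2 abs_mult)
  also have "\<bar>\<Sum>i<n. b ^ (n - Suc i) * a ^ i\<bar> \<le> (\<Sum>i<n. m ^ (n - 1))"
  proof (rule order_trans[OF sum_abs sum_mono])
    fix i assume "i \<in> {..<n}"
    then have "m ^ (n - Suc i) * m ^ i = m ^ (n - 1)" by (simp flip: power_add)
    moreover have "\<bar>b\<bar> ^ (n - Suc i) * \<bar>a\<bar> ^ i \<le> m ^ (n - Suc i) * m ^ i"
      using assms \<open>m \<ge> 0\<close> by (intro mult_mono power_mono) auto
    ultimately show "\<bar>b ^ (n - Suc i) * a ^ i\<bar> \<le> m ^ (n - 1)" by (simp add: abs_mult power_abs)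
  qed
  finally have "\<bar>a ^ n - b ^ n\<bar> \<le> \<bar>a - b\<bar> * (\<Sum>i<n. m ^ (n - 1))" by (simp add: mult_left_mono)
  then show ?thesis by (simp add: mult_ac)
qed

text \<open>Weighting by \<open>real n ^ 4\<close> keeps step size and eigenvalue out of the bound,
  so one \<open>K\<close> serves all modes and all \<open>\<delta>\<close>.\<close>

lemma R_real_power_error:
  assumes C: "1/78 < C" "C < 1/20"
  shows "\<exists>K\<ge>0. \<forall>x\<ge>0. \<forall>n. \<bar>R_real C (- x) ^ n - exp (- (real n * x))\<bar> * real n ^ 4 \<le> K"
proof (intro exI conjI allI impI)
  define q :: real where "q = 1/1000"
  have q: "0 < q" "q \<le> 1" by (auto simp: q_def)
  \<comment> \<open>\<open>K1\<close> serves \<open>x \<le> 1\<close>: 10 is the order constant,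
    \<open>exp q\<close> pays for passing from \<open>m ^ (n - 1)\<close> to \<open>m ^ n\<close>,
    and \<open>fact 5 / q^5\<close> absorbs the fifth power. \<open>K2\<close> serves
    \<open>x > 1\<close>, with 2 counting the two powers.\<close>
  define K1 K2 where "K1 = 10 * exp q * fact 5 / q^5" and "K2 = 2 * fact 4 / q^4"
  show "K1 + K2 \<ge> 0" using q by (simp add: K1_def K2_def)
  have K: "K1 \<ge> 0" "K2 \<ge> 0" using q by (auto simp: K1_def K2_def)
  fix x :: real and n :: nat assume x: "x \<ge> 0"
  define E where "E = exp (- x)"
  define m where "m = exp (- (q * min 1 x))"
  have En: "exp (- (real n * x)) = E ^ n" by (simp add: E_def exp_of_nat_mult[symmetric])
  have mn: "m ^ n = exp (- (real n * (q * min 1 x)))" by (simp add: m_def exp_of_nat_mult[symmetric])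
  have R: "\<bar>R_real C (- x)\<bar> \<le> m" using abs_R_real_le[OF C x] by (simp add: m_def q_def)
  \<comment> \<open>Since \<open>q \<le> 1\<close>, the exact factor \<open>E\<close> decays at
    least as fast as \<open>m\<close>, which thus majorizes both factors.\<close>
  have "q * min 1 x \<le> 1 * x" using q x by (intro mult_mono) auto
  then have E: "\<bar>E\<bar> \<le> m" by (simp add: E_def m_def)
  have "\<bar>R_real C (- x) ^ n - E ^ n\<bar> * real n ^ 4 \<le> K1 + K2"
  proof (cases "x \<le> 1")
    case True
    show ?thesis
    proof (cases n)
      case 0
      then show ?thesis using K by simp
    next
      case (Suc k)
      \<comment> \<open>\<open>n \<cdot> x^5 \<cdot> n^4 = (n x)^5\<close> is absorbed by the exponential decay in \<open>n x\<close>\<close>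
      define y where "y = real n * (q * x)"
      have "y \<ge> 0" using q x by (simp add: y_def)
      have "m ^ (n - 1) = m ^ n * exp (q * x)"
        using Suc True by (simp add: m_def min_absorb2 exp_minus)
      also have "\<dots> \<le> m ^ n * exp q"
        using True q by (intro mult_left_mono) (auto simp: m_def mult_left_le)
      finally have m1: "m ^ (n - 1) \<le> exp (- y) * exp q" using True by (simp add: mn y_def)
      have "\<bar>R_real C (- x) ^ n - E ^ n\<bar> * real n ^ 4
          \<le> (real n * \<bar>R_real C (- x) - E\<bar> * m ^ (n - 1)) * real n ^ 4"
        using abs_power_diff_le[OF R E] by (intro mult_right_mono) auto
      also have "\<dots> \<le> (real n * (10 * x^5) * (exp (- y) * exp q)) * real n ^ 4"
        using R_real_order[OF C x True] m1 x
        by (intro mult_right_mono mult_mono) (auto simp: E_def m_def)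
      also have "\<dots> = 10 * exp q / q^5 * (y^5 * exp (- y))"
        using q by (simp add: y_def power_mult_distrib field_simps eval_nat_numeral)
      also have "\<dots> \<le> 10 * exp q / q^5 * fact 5"
        using pow_le_fact_exp[OF \<open>y \<ge> 0\<close>, of 5] q
        by (intro mult_left_mono) (auto simp: exp_minus field_simps)
      finally show ?thesis using K by (simp add: K1_def)
    qed
  next
    case False
    have "\<bar>R_real C (- x) ^ n - E ^ n\<bar> \<le> \<bar>R_real C (- x)\<bar> ^ n + \<bar>E\<bar> ^ n"
      using abs_triangle_ineq4[of "R_real C (- x) ^ n" "E ^ n"] by (simp add: power_abs)
    also have "\<dots> \<le> m ^ n + m ^ n"
      using R E by (intro add_mono power_mono) auto
    also have "\<dots> = 2 * exp (- (real n * q))" using False by (simp add: mn)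
    finally have "\<bar>R_real C (- x) ^ n - E ^ n\<bar> * real n ^ 4 \<le> 2 * exp (- (real n * q)) * real n ^ 4"
      by (intro mult_right_mono) auto
    also have "\<dots> = 2 / q^4 * ((real n * q)^4 * exp (- (real n * q)))"
      using q by (simp add: power_mult_distrib field_simps)
    also have "\<dots> \<le> 2 / q^4 * fact 4"
      using pow_le_fact_exp[of "real n * q" 4] q
      by (intro mult_left_mono) (auto simp: exp_minus field_simps)
    finally show ?thesis using K by (simp add: K2_def)
  qed
  then show "\<bar>R_real C (- x) ^ n - exp (- (real n * x))\<bar> * real n ^ 4 \<le> K1 + K2" by (simp add: En)
qed

section \<open>The discretized operator\<close>

context
  fixes M :: "'v::real_normed_vector \<Rightarrow> 'v" and E :: "'v set" and \<mu> :: "'v \<Rightarrow> real"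
  assumes lin: "linear M" and eigen: "\<And>e. e \<in> E \<Longrightarrow> M e = \<mu> e *\<^sub>R e"
begin

lemma funpow_eigen_sum:
  "(M ^^ k) (\<Sum>e\<in>E. c e *\<^sub>R e) = (\<Sum>e\<in>E. (\<mu> e ^ k * c e) *\<^sub>R e)"
proof (induction k)
  case (Suc k)
  then show ?case
    by (simp add: linear_sum[OF lin] linear_cmul[OF lin] eigen mult_ac cong: sum.cong)
qed simp

lemma poly_op_eigen_sum:
  "poly_op p M (\<Sum>e\<in>E. c e *\<^sub>R e) = (\<Sum>e\<in>E. (poly p (\<mu> e) * c e) *\<^sub>R e)"
proof -
  have "poly_op p M (\<Sum>e\<in>E. c e *\<^sub>R e)
      = (\<Sum>i\<le>degree p. \<Sum>e\<in>E. (coeff p i * (\<mu> e ^ i * c e)) *\<^sub>R e)"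
    by (simp add: poly_op_def funpow_eigen_sum scaleR_sum_right)
  also have "\<dots> = (\<Sum>e\<in>E. \<Sum>i\<le>degree p. (coeff p i * (\<mu> e ^ i * c e)) *\<^sub>R e)"
    by (rule sum.swap)
  finally show ?thesis
    by (simp add: poly_altdef sum_distrib_right scaleR_sum_left mult.assoc)
qed

lemma op_exp_eigen_sum:
  "op_exp M (\<Sum>e\<in>E. c e *\<^sub>R e) = (\<Sum>e\<in>E. (exp (\<mu> e) * c e) *\<^sub>R e)"
proof -
  have "(\<lambda>k. \<Sum>e\<in>E. (\<mu> e ^ k /\<^sub>R fact k) *\<^sub>R (c e *\<^sub>R e)) sums (\<Sum>e\<in>E. exp (\<mu> e) *\<^sub>R (c e *\<^sub>R e))"
    by (intro sums_sum sums_scaleR_left exp_converges)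
  moreover have "(1 / fact k) *\<^sub>R (M ^^ k) (\<Sum>e\<in>E. c e *\<^sub>R e)
      = (\<Sum>e\<in>E. (\<mu> e ^ k /\<^sub>R fact k) *\<^sub>R (c e *\<^sub>R e))" for k
    by (simp add: funpow_eigen_sum scaleR_sum_right divide_inverse mult_ac)
  ultimately show ?thesis
    by (simp add: op_exp_def sums_iff)
qed

text \<open>Dividing the coefficients produces a preimage, and injectivity identifies it with the
  value of the inverse.\<close>

lemma inv_poly_op_eigen_sum:
  assumes "bij (poly_op p M)" and "\<And>e. e \<in> E \<Longrightarrow> poly p (\<mu> e) \<noteq> 0"
  shows "inv (poly_op p M) (\<Sum>e\<in>E. c e *\<^sub>R e) = (\<Sum>e\<in>E. (c e / poly p (\<mu> e)) *\<^sub>R e)"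
proof (rule inv_f_eq[OF bij_is_inj[OF assms(1)]])
  show "poly_op p M (\<Sum>e\<in>E. (c e / poly p (\<mu> e)) *\<^sub>R e) = (\<Sum>e\<in>E. c e *\<^sub>R e)"
    unfolding poly_op_eigen_sum using assms(2) by (intro sum.cong) auto
qed

lemma R_op_eigen_sum:
  assumes bij: "bij (poly_op [:1, -1/4, 1/48:] M)" "bij (poly_op [:1, - coeff_a2 C, 3/2 * C:] M)"
    and nz: "\<And>e. e \<in> E \<Longrightarrow> poly [:1, -1/4, 1/48:] (\<mu> e) \<noteq> 0"
      "\<And>e. e \<in> E \<Longrightarrow> poly [:1, - coeff_a2 C, 3/2 * C:] (\<mu> e) \<noteq> 0"
  shows "R_op C M (\<Sum>e\<in>E. c e *\<^sub>R e) = (\<Sum>e\<in>E. (R_real C (\<mu> e) * c e) *\<^sub>R e)"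
proof -
  have "H_op M (\<Sum>e\<in>E. c e *\<^sub>R e)
      = (\<Sum>e\<in>E. (poly [:1, 1/4, 1/48:] (\<mu> e) * c e / poly [:1, -1/4, 1/48:] (\<mu> e)) *\<^sub>R e)"
    unfolding H_op_def poly_op_eigen_sum by (rule inv_poly_op_eigen_sum[OF bij(1) nz(1)])
  then have "R_op C M (\<Sum>e\<in>E. c e *\<^sub>R e) = inv (poly_op [:1, - coeff_a2 C, 3/2 * C:] M)
      (\<Sum>e\<in>E. (poly [:1, coeff_a0 C, C:] (\<mu> e) * c e + poly [:0, coeff_a1 C, - C:] (\<mu> e)
        * (poly [:1, 1/4, 1/48:] (\<mu> e) * c e / poly [:1, -1/4, 1/48:] (\<mu> e))) *\<^sub>R e)"
    by (simp only: R_op_def poly_op_eigen_sum sum.distrib[symmetric] scaleR_add_left[symmetric])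
  also have "\<dots> = (\<Sum>e\<in>E. ((poly [:1, coeff_a0 C, C:] (\<mu> e) * c e + poly [:0, coeff_a1 C, - C:] (\<mu> e)
        * (poly [:1, 1/4, 1/48:] (\<mu> e) * c e / poly [:1, -1/4, 1/48:] (\<mu> e)))
        / poly [:1, - coeff_a2 C, 3/2 * C:] (\<mu> e)) *\<^sub>R e)"
    by (rule inv_poly_op_eigen_sum[OF bij(2) nz(2)])
  also have "\<dots> = (\<Sum>e\<in>E. (R_real C (\<mu> e) * c e) *\<^sub>R e)"
  proof -
    have "(p * x + q * (r * x / h)) / d = ((p + q * (r / h)) / d) * x" for p q r h d x :: real
      by (simp add: algebra_simps add_divide_distrib)
    then show ?thesis by (simp only: R_real_def)
  qed
  finally show ?thesis .
qed

end

lemma funpow_R_op_eigen_sum: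
  fixes M :: "'v::real_normed_vector \<Rightarrow> 'v"
  assumes "linear M" "\<And>e. e \<in> E \<Longrightarrow> M e = \<mu> e *\<^sub>R e"
    and "bij (poly_op [:1, -1/4, 1/48:] M)" "bij (poly_op [:1, - coeff_a2 C, 3/2 * C:] M)"
    and "\<And>e. e \<in> E \<Longrightarrow> poly [:1, -1/4, 1/48:] (\<mu> e) \<noteq> 0"
      "\<And>e. e \<in> E \<Longrightarrow> poly [:1, - coeff_a2 C, 3/2 * C:] (\<mu> e) \<noteq> 0"
  shows "(R_op C M ^^ n) (\<Sum>e\<in>E. c e *\<^sub>R e) = (\<Sum>e\<in>E. (R_real C (\<mu> e) ^ n * c e) *\<^sub>R e)"
proof (induction n)
  case (Suc n)
  then show ?case by (simp add: R_op_eigen_sum[OF assms] mult.assoc)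
qed simp

text \<open>The cross coefficient \<open>\<delta> + \<delta>\<^sub>0\<close> is the one making \<open>block_op a G D \<delta>\<close> self-adjoint. The weight
  \<open>\<delta>\<^sub>0 / a\<close> is kept independent of \<open>\<delta>\<close>, since the \<open>\<delta>\<close>-dependent energy weights degenerate as
  \<open>\<delta> \<rightarrow> 0\<close>.\<close>

definition sym_form ::
  "real \<Rightarrow> ('x::euclidean_space \<Rightarrow> 'q::euclidean_space) \<Rightarrow> real \<Rightarrow> real \<Rightarrow> 'x \<times> 'q \<Rightarrow> 'x \<times> 'q \<Rightarrow> real" where
  "sym_form a G \<delta>\<^sub>0 \<delta> u v = fst u \<bullet> fst v + \<delta>\<^sub>0 / a * (snd u \<bullet> snd v)
     + (\<delta> + \<delta>\<^sub>0) * (G (fst u) \<bullet> snd v + G (fst v) \<bullet> snd u)"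

section \<open>Uniform estimates in the symmetrizing form\<close>

locale damped_discretization =
  fixes a :: real and G :: "'x::euclidean_space \<Rightarrow> 'q::euclidean_space" and D :: "'q \<Rightarrow> 'x"
    and \<delta>\<^sub>0 :: real
  assumes disc: "compatible_discretization a G D"
    and \<delta>\<^sub>0_pos: "\<delta>\<^sub>0 > 0"
    and overdamped: "4 * a * \<delta>\<^sub>0 * (sigma_max G)\<^sup>2 < 1"
begin

lemma a_pos: "a > 0" and G: "linear G" and D: "D = (\<lambda>q. - adjoint G q)" and linD: "linear D"
  using disc unfolding compatible_discretization_def by blast+

lemma D_inner: "D q \<bullet> x = - (q \<bullet> G x)" "x \<bullet> D q = - (q \<bullet> G x)"
  using adjoint_works[OF G, of x q] by (simp_all add: D inner_commute)

lemma linear_block_op: "linear (block_op a G D \<delta>)"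
  unfolding block_op_def
  by (rule linearI)
    (auto simp: linear_add[OF G] linear_add[OF linD] linear_cmul[OF G] linear_cmul[OF linD]
      split_beta algebra_simps)

text \<open>Worst relative size of the cross term in \<open>sym_form\<close> against its diagonal
  part. Its square is the left side of \<open>overdamped\<close>, so that assumption says
  \<open>\<kappa> < 1\<close>.\<close>

definition \<kappa> :: real where "\<kappa> = 2 * sigma_max G * sqrt (a * \<delta>\<^sub>0)"

lemma \<kappa>_bounds: "0 \<le> \<kappa>" "\<kappa> < 1"
proof -
  show "0 \<le> \<kappa>" using sigma_max_nonneg[OF G] a_pos \<delta>\<^sub>0_pos by (simp add: \<kappa>_def)
  have "\<kappa>\<^sup>2 < 1\<^sup>2"
    using overdamped a_pos \<delta>\<^sub>0_pos by (simp add: \<kappa>_def power_mult_distrib mult_ac)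
  then show "\<kappa> < 1" by (rule power_less_imp_less_base) simp
qed

text \<open>Cauchy-Schwarz and \<open>norm_le_sigma_max\<close> bound the cross term by
  \<open>\<kappa>\<close> times the diagonal part. As
  \<open>\<delta> + \<delta>\<^sub>0 \<le> 2 * \<delta>\<^sub>0\<close>, the constants do not depend
  on \<open>\<delta>\<close>.\<close>

lemma sym_form_bounds:
  assumes "0 < \<delta>" "\<delta> \<le> \<delta>\<^sub>0"
  shows "(1 - \<kappa>) * min 1 (\<delta>\<^sub>0 / a) * (norm u)\<^sup>2 \<le> sym_form a G \<delta>\<^sub>0 \<delta> u u"
    and "sym_form a G \<delta>\<^sub>0 \<delta> u u \<le> (1 + \<kappa>) * max 1 (\<delta>\<^sub>0 / a) * (norm u)\<^sup>2"
proof -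
  obtain x q where u: "u = (x, q)" by (cases u)
  define \<beta> where "\<beta> = \<delta>\<^sub>0 / a"
  define N where "N = (norm x)\<^sup>2 + \<beta> * (norm q)\<^sup>2"
  have \<beta>: "\<beta> > 0" using a_pos \<delta>\<^sub>0_pos by (simp add: \<beta>_def)
  have nu: "(norm u)\<^sup>2 = (norm x)\<^sup>2 + (norm q)\<^sup>2" by (simp add: u norm_Pair)
  have "\<bar>2 * (\<delta> + \<delta>\<^sub>0) * (G x \<bullet> q)\<bar> \<le> \<kappa> * N"
  proof -
    have "\<bar>G x \<bullet> q\<bar> \<le> norm (G x) * norm q" by (rule Cauchy_Schwarz_ineq2)
    also have "\<dots> \<le> sigma_max G * norm x * norm q"
      by (intro mult_right_mono norm_le_sigma_max[OF G]) auto
    finally have "(2 * (\<delta> + \<delta>\<^sub>0)) * \<bar>G x \<bullet> q\<bar> \<le> (4 * \<delta>\<^sub>0) * (sigma_max G * norm x * norm q)"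
      by (rule mult_mono[rotated]) (use assms in auto)
    \<comment> \<open>Splitting \<open>\<delta>\<^sub>0\<close> as
      \<open>sqrt (a * \<delta>\<^sub>0) * sqrt \<beta>\<close> gives one root to
      \<open>\<kappa>\<close> and the other to the weight of \<open>q\<close>.\<close>
    also have "\<dots> = \<kappa> * (2 * norm x * (sqrt \<beta> * norm q))"
    proof -
      have "sqrt (a * \<delta>\<^sub>0) * sqrt \<beta> = \<delta>\<^sub>0"
        using a_pos \<delta>\<^sub>0_pos by (simp add: \<beta>_def flip: real_sqrt_mult)
      then have "4 * \<delta>\<^sub>0 * (sigma_max G * norm x * norm q)
          = 4 * (sqrt (a * \<delta>\<^sub>0) * sqrt \<beta>) * (sigma_max G * norm x * norm q)" by simp
      then show ?thesis by (simp add: \<kappa>_def mult_ac)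
    qed
    also have "\<dots> \<le> \<kappa> * N"
    proof -
      have "2 * norm x * (sqrt \<beta> * norm q) \<le> (norm x)\<^sup>2 + (sqrt \<beta> * norm q)\<^sup>2"
        by (rule sum_squares_bound)
      then show ?thesis
        using \<kappa>_bounds \<beta> by (intro mult_left_mono) (simp_all add: N_def power_mult_distrib)
    qed
    finally show ?thesis using assms by (simp add: abs_mult)
  qed
  moreover have "sym_form a G \<delta>\<^sub>0 \<delta> u u = N + 2 * (\<delta> + \<delta>\<^sub>0) * (G x \<bullet> q)"
    by (simp add: sym_form_def u N_def \<beta>_def power2_norm_eq_inner)
  ultimately have "(1 - \<kappa>) * N \<le> sym_form a G \<delta>\<^sub>0 \<delta> u u" "sym_form a G \<delta>\<^sub>0 \<delta> u u \<le> (1 + \<kappa>) * N"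
    by (simp_all add: abs_le_iff algebra_simps)
  moreover have "min 1 \<beta> * (norm u)\<^sup>2 \<le> N"
    using mult_right_mono[of "min 1 \<beta>" 1 "(norm x)\<^sup>2"] mult_right_mono[of "min 1 \<beta>" \<beta> "(norm q)\<^sup>2"]
    by (simp add: nu N_def distrib_left)
  moreover have "N \<le> max 1 \<beta> * (norm u)\<^sup>2"
    using mult_right_mono[of 1 "max 1 \<beta>" "(norm x)\<^sup>2"] mult_right_mono[of \<beta> "max 1 \<beta>" "(norm q)\<^sup>2"]
    by (simp add: nu N_def distrib_left)
  ultimately show "(1 - \<kappa>) * min 1 (\<delta>\<^sub>0 / a) * (norm u)\<^sup>2 \<le> sym_form a G \<delta>\<^sub>0 \<delta> u u"
    and "sym_form a G \<delta>\<^sub>0 \<delta> u u \<le> (1 + \<kappa>) * max 1 (\<delta>\<^sub>0 / a) * (norm u)\<^sup>2"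
    using \<kappa>_bounds unfolding \<beta>_def mult.assoc
    by (meson diff_ge_0_iff_ge less_imp_le mult_left_mono order_trans,
        meson add_nonneg_nonneg mult_left_mono order_trans zero_le_one)
qed

text \<open>For \<open>u = (x, q)\<close> and \<open>v = (y, r)\<close>, the coefficient of
  \<open>q \<bullet> G y\<close> is \<open>1 - (\<delta> + \<delta>\<^sub>0) / \<delta> = -
  \<delta>\<^sub>0 / \<delta>\<close>, which is also that of \<open>G x \<bullet> r\<close>. The
  other terms are symmetric, the one with \<open>G (D q)\<close> because \<open>D\<close> is minus
  the adjoint. Definiteness is the lower bound of \<open>sym_form_bounds\<close>.\<close>

lemma self_adjoint_block_op:
  assumes "0 < \<delta>" "\<delta> \<le> \<delta>\<^sub>0"
  shows "self_adjoint_form (sym_form a G \<delta>\<^sub>0 \<delta>) (block_op a G D \<delta>)"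
proof (rule self_adjoint_form.intro)
  show "bilinear (sym_form a G \<delta>\<^sub>0 \<delta>)"
    unfolding bilinear_def
    by (auto intro!: linearI simp: sym_form_def linear_add[OF G] linear_cmul[OF G]
        inner_add_left inner_add_right add_divide_distrib algebra_simps)
  show "sym_form a G \<delta>\<^sub>0 \<delta> u v = sym_form a G \<delta>\<^sub>0 \<delta> v u" for u v
    by (simp add: sym_form_def inner_commute add_ac)
  show "sym_form a G \<delta>\<^sub>0 \<delta> u u > 0" if "u \<noteq> 0" for u
  proof -
    have "0 < (1 - \<kappa>) * min 1 (\<delta>\<^sub>0 / a) * (norm u)\<^sup>2"
      using \<kappa>_bounds a_pos \<delta>\<^sub>0_pos that by simp
    then show ?thesis using sym_form_bounds(1)[OF assms, of u] by linarith
  qed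
  show "linear (block_op a G D \<delta>)" by (rule linear_block_op)
  show "sym_form a G \<delta>\<^sub>0 \<delta> (block_op a G D \<delta> u) v = sym_form a G \<delta>\<^sub>0 \<delta> u (block_op a G D \<delta> v)"
    for u v
  proof -
    obtain x q y r where "u = (x, q)" "v = (y, r)" by (metis prod.exhaust)
    moreover have "q \<bullet> G (D r) = r \<bullet> G (D q)"
      using D_inner(1)[of q "D r"] D_inner(1)[of r "D q"] by (simp add: inner_commute)
    ultimately show ?thesis
      using assms a_pos
      by (simp add: sym_form_def block_op_def D_inner linear_neg[OF G] inner_diff_left
          inner_diff_right field_simps)
        (simp add: inner_commute algebra_simps)
  qed
qed

text \<open>Pairing the eigenvalue equation with the eigenvector in the energy
  \<open>a * (x \<bullet> x) + \<delta> * (q \<bullet> q)\<close> leaves only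
  \<open>- (q \<bullet> q)\<close>. Only a sign is needed, so the \<open>\<delta>\<close>-dependent
  weight does no harm.\<close>

lemma block_op_eigenvalue_nonpos:
  assumes "\<delta> > 0" and e: "e \<noteq> 0" "block_op a G D \<delta> e = \<mu> *\<^sub>R e"
  shows "\<mu> \<le> 0"
proof -
  obtain x q where xq: "e = (x, q)" by (cases e)
  have x: "\<mu> *\<^sub>R x = - D q" and q: "\<mu> *\<^sub>R q = - (a / \<delta>) *\<^sub>R G x - (1 / \<delta>) *\<^sub>R q"
    using e(2) by (simp_all add: xq block_op_def)
  have "\<mu> * (a * (x \<bullet> x) + \<delta> * (q \<bullet> q)) = a * ((\<mu> *\<^sub>R x) \<bullet> x) + \<delta> * ((\<mu> *\<^sub>R q) \<bullet> q)"
    by (simp add: algebra_simps)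
  also have "\<dots> = - (q \<bullet> q)"
    unfolding x q using assms(1) by (simp add: D_inner inner_diff_left inner_commute[of "G x" q] field_simps)
  finally have "\<mu> * (a * (x \<bullet> x) + \<delta> * (q \<bullet> q)) \<le> 0" by simp
  moreover have "a * (x \<bullet> x) + \<delta> * (q \<bullet> q) > 0"
  proof (cases "x = 0")
    case True
    then show ?thesis using e xq assms(1) by (simp add: zero_prod_def)
  next
    case False
    then show ?thesis using a_pos assms(1) by (simp add: add_pos_nonneg)
  qed
  ultimately show ?thesis by (simp add: mult_le_0_iff)
qed

text \<open>In an orthogonal eigenbasis the operator error acts by the scalar errors. The square
  root is the price of changing from the norm to \<open>sym_form\<close> and back, and it is free of
  \<open>\<delta>\<close>.\<close>

lemma R_op_exp_error:
  assumes C: "C \<in> {C_minus..C_plus}" and \<delta>: "0 < \<delta>" "\<delta> \<le> \<delta>\<^sub>0" and \<tau>: "\<tau> > 0"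
    and \<epsilon>: "\<And>x. x \<ge> 0 \<Longrightarrow> \<bar>R_real C (- x) ^ n - exp (- (real n * x))\<bar> \<le> \<epsilon>"
  shows "norm ((R_op C (\<lambda>u. \<tau> *\<^sub>R block_op a G D \<delta> u) ^^ n) u
             - op_exp (\<lambda>u. (real n * \<tau>) *\<^sub>R block_op a G D \<delta> u) u)
         \<le> \<epsilon> * sqrt ((1 + \<kappa>) * max 1 (\<delta>\<^sub>0 / a) / ((1 - \<kappa>) * min 1 (\<delta>\<^sub>0 / a))) * norm u"
    (is "norm ?err \<le> \<epsilon> * sqrt (?hi / ?lo) * norm u")
proof -
  interpret self_adjoint_form "sym_form a G \<delta>\<^sub>0 \<delta>" "block_op a G D \<delta>"
    by (rule self_adjoint_block_op[OF \<delta>])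
  obtain E \<mu> where E: "finite E" "span E = UNIV"
    and eig: "\<And>e. e \<in> E \<Longrightarrow> block_op a G D \<delta> e = \<mu> e *\<^sub>R e" and nz: "\<And>e. e \<in> E \<Longrightarrow> e \<noteq> 0"
    and orth: "\<And>e f. e \<in> E \<Longrightarrow> f \<in> E \<Longrightarrow> e \<noteq> f \<Longrightarrow> sym_form a G \<delta>\<^sub>0 \<delta> e f = 0"
    using eigenbasis by blast
  obtain c where u: "u = (\<Sum>e\<in>E. c e *\<^sub>R e)"
    using span_finite[OF E(1)] E(2) by blast
  have nonneg: "- (\<tau> * \<mu> e) \<ge> 0" if "e \<in> E" for e
    using block_op_eigenvalue_nonpos[OF \<delta>(1) nz[OF that] eig[OF that]] \<tau>
    by (simp add: mult_nonneg_nonpos)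
  define g where "g = (\<lambda>e. R_real C (\<tau> * \<mu> e) ^ n - exp (real n * \<tau> * \<mu> e))"
  have g: "\<bar>g e\<bar> \<le> \<epsilon>" if "e \<in> E" for e
    using \<epsilon>[OF nonneg[OF that]] by (simp add: g_def mult.assoc)
  have lin_smult: "linear (\<lambda>u. s *\<^sub>R block_op a G D \<delta> u)" for s
    using linear_compose_scale_right[OF lin] .
  have "?err = (\<Sum>e\<in>E. (R_real C (\<tau> * \<mu> e) ^ n * c e) *\<^sub>R e)
      - (\<Sum>e\<in>E. (exp (real n * \<tau> * \<mu> e) * c e) *\<^sub>R e)"
  proof -
    have "(R_op C (\<lambda>u. \<tau> *\<^sub>R block_op a G D \<delta> u) ^^ n) u
        = (\<Sum>e\<in>E. (R_real C (\<tau> * \<mu> e) ^ n * c e) *\<^sub>R e)"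
      unfolding u
    proof (rule funpow_R_op_eigen_sum[OF lin_smult])
      fix e assume e: "e \<in> E"
      show "\<tau> *\<^sub>R block_op a G D \<delta> e = (\<tau> * \<mu> e) *\<^sub>R e" by (simp add: eig[OF e])
      show "poly [:1, -1/4, 1/48:] (\<tau> * \<mu> e) \<noteq> 0"
        using H_den_pos[OF C_bounds[OF C] nonneg[OF e]] by simp
      show "poly [:1, - coeff_a2 C, 3/2 * C:] (\<tau> * \<mu> e) \<noteq> 0"
        using R_den2_pos[OF C_bounds[OF C] nonneg[OF e]] by simp
    qed (rule denominators_bij[OF disc \<delta>(1) \<tau> C])+
    moreover have "op_exp (\<lambda>u. (real n * \<tau>) *\<^sub>R block_op a G D \<delta> u) u
        = (\<Sum>e\<in>E. (exp (real n * \<tau> * \<mu> e) * c e) *\<^sub>R e)"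
      unfolding u by (rule op_exp_eigen_sum[OF lin_smult]) (simp add: eig)
    ultimately show ?thesis by simp
  qed
  also have "\<dots> = (\<Sum>e\<in>E. (g e * c e) *\<^sub>R e)"
    by (simp add: g_def left_diff_distrib scaleR_diff_left sum_subtractf)
  finally have err: "?err = (\<Sum>e\<in>E. (g e * c e) *\<^sub>R e)" .
  have lo: "?lo > 0" using \<kappa>_bounds a_pos \<delta>\<^sub>0_pos by simp
  have hi: "?hi \<ge> 0" using \<kappa>_bounds by simp
  \<comment> \<open>The scalar bound at \<open>x = 0\<close> forces \<open>\<epsilon>\<close> to be
    nonnegative.\<close>
  have \<epsilon>0: "\<epsilon> \<ge> 0" using order_trans[OF abs_ge_zero \<epsilon>[of 0]] by simp
  have "?lo * (norm ?err)\<^sup>2 \<le> sym_form a G \<delta>\<^sub>0 \<delta> ?err ?err"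
    by (rule sym_form_bounds(1)[OF \<delta>])
  also have "\<dots> \<le> \<epsilon>\<^sup>2 * sym_form a G \<delta>\<^sub>0 \<delta> u u"
  proof -
    have "sym_form a G \<delta>\<^sub>0 \<delta> (\<Sum>e\<in>E. (g e * c e) *\<^sub>R e) (\<Sum>e\<in>E. (g e * c e) *\<^sub>R e)
        \<le> \<epsilon>\<^sup>2 * sym_form a G \<delta>\<^sub>0 \<delta> (\<Sum>e\<in>E. c e *\<^sub>R e) (\<Sum>e\<in>E. c e *\<^sub>R e)"
      by (intro form_orthogonal_sum_le E(1) orth g)
    then show ?thesis by (simp only: err u[symmetric])
  qed
  also have "\<dots> \<le> \<epsilon>\<^sup>2 * (?hi * (norm u)\<^sup>2)"
    by (intro mult_left_mono sym_form_bounds(2)[OF \<delta>]) auto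
  finally have "(norm ?err)\<^sup>2 \<le> \<epsilon>\<^sup>2 * (?hi / ?lo) * (norm u)\<^sup>2"
    using lo by (simp add: pos_le_divide_eq mult_ac)
  also have "\<dots> = (\<epsilon> * sqrt (?hi / ?lo) * norm u)\<^sup>2"
    using lo hi by (simp add: power_mult_distrib)
  finally show ?thesis
    by (rule power2_le_imp_le) (use lo hi \<epsilon>0 in simp)
qed

end

theorem theorem7:
  fixes G :: "'x::euclidean_space \<Rightarrow> 'q::euclidean_space"
    and D :: "'q \<Rightarrow> 'x"
    and a \<delta>\<^sub>0 t\<^sub>0 T C :: real
  assumes "compatible_discretization a G D"
    and "\<delta>\<^sub>0 > 0"
    and "4 * a * \<delta>\<^sub>0 * (sigma_max G)\<^sup>2 < 1"
    and "0 < t\<^sub>0" and "t\<^sub>0 < T"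
    and "C \<in> {C_minus..C_plus}"
  shows "\<exists>K::real. \<forall>U\<^sub>0 :: real \<Rightarrow> 'x \<times> 'q.
           (\<exists>B. \<forall>\<delta>\<in>{0<..\<delta>\<^sub>0}. norm (U\<^sub>0 \<delta>) \<le> B) \<longrightarrow>
           (\<forall>\<delta>\<in>{0<..\<delta>\<^sub>0}. \<forall>\<Delta>t>0. \<forall>n::nat. t\<^sub>0 \<le> real n * \<Delta>t \<and> real n * \<Delta>t \<le> T \<longrightarrow>
              norm ((R_op C (\<lambda>u. \<Delta>t *\<^sub>R block_op a G D \<delta> u) ^^ n) (U\<^sub>0 \<delta>)
                    - op_exp (\<lambda>u. (real n * \<Delta>t) *\<^sub>R block_op a G D \<delta> u) (U\<^sub>0 \<delta>))
                \<le> K * \<Delta>t ^ 4 * norm (U\<^sub>0 \<delta>))"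
proof -
  interpret damped_discretization a G D \<delta>\<^sub>0
    using assms by unfold_locales
  obtain K where K: "K \<ge> 0"
    and err: "\<And>x n. x \<ge> 0 \<Longrightarrow> \<bar>R_real C (- x) ^ n - exp (- (real n * x))\<bar> * real n ^ 4 \<le> K"
    using R_real_power_error[OF C_bounds[OF assms(6)]] by blast
  define L where "L = sqrt ((1 + \<kappa>) * max 1 (\<delta>\<^sub>0 / a) / ((1 - \<kappa>) * min 1 (\<delta>\<^sub>0 / a)))"
  \<comment> \<open>Since \<open>n\<close> is at least \<open>t\<^sub>0 / \<Delta>t\<close>, the
    scalar bound \<open>K / real n ^ 4\<close> becomes
    \<open>K / t\<^sub>0 ^ 4 * \<Delta>t ^ 4\<close>; the factor \<open>L\<close> comes from the
    change of norm. Both are fixed before \<open>\<delta>\<close>, \<open>\<Delta>t\<close> and the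
    data.\<close>
  show ?thesis
  proof (intro exI[of _ "K / t\<^sub>0 ^ 4 * L"] allI impI ballI, elim conjE)
    fix U\<^sub>0 :: "real \<Rightarrow> 'x \<times> 'q" and \<delta> \<Delta>t :: real and n :: nat
    assume \<delta>: "\<delta> \<in> {0<..\<delta>\<^sub>0}" and \<Delta>t: "\<Delta>t > 0" and n: "t\<^sub>0 \<le> real n * \<Delta>t"
    have n0: "real n > 0" using n \<open>0 < t\<^sub>0\<close> by (cases n) auto
    have "\<bar>R_real C (- x) ^ n - exp (- (real n * x))\<bar> \<le> K / t\<^sub>0 ^ 4 * \<Delta>t ^ 4" if "x \<ge> 0" for x
    proof -
      have "\<bar>R_real C (- x) ^ n - exp (- (real n * x))\<bar> \<le> K / real n ^ 4"
        using err[OF that, of n] n0 by (simp add: pos_le_divide_eq)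
      also have "\<dots> \<le> K / (t\<^sub>0 / \<Delta>t) ^ 4"
        using n n0 \<Delta>t K \<open>0 < t\<^sub>0\<close>
        by (intro divide_left_mono power_mono mult_pos_pos) (auto simp: pos_divide_le_eq)
      finally show ?thesis by (simp add: power_divide)
    qed
    from R_op_exp_error[OF assms(6) _ _ \<Delta>t this, of \<delta> "U\<^sub>0 \<delta>"] \<delta>
    show "norm ((R_op C (\<lambda>u. \<Delta>t *\<^sub>R block_op a G D \<delta> u) ^^ n) (U\<^sub>0 \<delta>)
              - op_exp (\<lambda>u. (real n * \<Delta>t) *\<^sub>R block_op a G D \<delta> u) (U\<^sub>0 \<delta>))
          \<le> K / t\<^sub>0 ^ 4 * L * \<Delta>t ^ 4 * norm (U\<^sub>0 \<delta>)"
      by (simp add: L_def mult_ac)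
  qed
qed

end
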